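(* Let $\ast$ be a continuous t-norm, let $X$ be a compactum and let $\mu\in\mathcal T(X)$. Then $\mu$ is balanced (i.e. $\mu\in\mathcal{BT}(X)$) if and only if there exists a balanced capacity $\nu\in MBX$ such that $\mu(\varphi)=\int_X^{\vee\ast}\varphi\,d\nu$ for each $\varphi\in C(X,[0,1])$.
   Context: A compactum is a compact Hausdorff space. For a compactum $X$, $\mathcal F(X)$ is the family of all closed subsets of $X$. An (upper-semicontinuous) capacity on $X$ is a function $\nu:\mathcal F(X)\to[0,1]$ such that for all closed $F,G\subset X$: (1) $\nu(X)=1$, $\nu(\emptyset)=0$; (2) if $F\subset G$ then $\nu(F)\le\nu(G)$; (3) if $\nu(F)<a$ then there is an open set $O\supset F$ such that $\nu(B)<a$ for each compact $B\subset O$. $MX$ is the set of all capacities on $X$. A capacity $\nu\in MX$ is balanced if $\sum_{i=1}^n\lambda_i\nu(A_i)\le 1$ for all $n$, all non-negative real numbers $\lambda_1,\dots,\lambda_n$ and all closed $A_1,\dots,A_n\subset X$ with $\sum_{i=1}^n\lambda_i\chi_{A_i}\le 1_X$ pointwise ($\chi_A$ is the characteristic function of $A$, $1_X$ the constant function $1$). $MBX=MB(X)\subset MX$ is the set of balanced capacities. A t-norm $\ast$ is a binary operation on $[0,1]$ which is associative, commutative, monotone and satisfies $s\ast1=s$ for each $s\in[0,1]$. $C(X,[0,1])$ is the set of continuous functions $X\to[0,1]$ with pointwise order. For $f\in C(X,[0,1])$ and $t\in[0,1]$ put $f_t=f^{-1}([t,+\infty))$. For a continuous t-norm $\ast$,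 the t-normed integral of $f\in C(X,[0,1])$ with respect to $\nu\in MX$ is $\int_X^{\vee\ast}f\,d\nu=\max\{\nu(f_t)\ast t\mid t\in[0,1]\}$. Functions $\varphi,\psi$ on $X$ are comonotone if $(\varphi(x_1)-\varphi(x_2))(\psi(x_1)-\psi(x_2))\ge0$ for all $x_1,x_2\in X$. For the given continuous t-norm $\ast$, $\mathcal T(X)$ is the set of functionals $\mu:C(X,[0,1])\to[0,1]$ such that: (1) $\mu(1_X)=1$; (2) $\mu(\varphi)\le\mu(\psi)$ whenever $\varphi\le\psi$; (3) $\mu(\psi\vee\varphi)=\mu(\psi)\vee\mu(\varphi)$ for all comonotone $\varphi,\psi$ ($\vee$ denotes (pointwise) maximum); (4) $\mu(c_X\ast\varphi)=c\ast\mu(\varphi)$ for all $c\in[0,1]$ and all $\varphi$, where $c_X$ is the constant function $c$ and $\ast$ is applied pointwise. A functional $\mu\in\mathcal T(X)$ is balanced if for all $n$, all non-negative real numbers $\lambda_1,\dots,\lambda_n$ and all closed subsets $A_1,\dots,A_n$ of $X$ with $\sum_{i=1}^n\lambda_i\chi_{A_i}\le1_X$ there exist $\varphi_1,\dots,\varphi_n\in C(X,[0,1])$ such that $\chi_{A_i}\le\varphi_i$ for each $i$ and $\sum_{i=1}^n\lambda_i\mu(\varphi_i)\le1$. $\mathcal{BT}(X)$ is the set of balanced functionals in $\mathcal T(X)$. *)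

theory Defs
  imports "HOL-Analysis.Analysis"
begin

definition compactum :: "'a topology \<Rightarrow> bool" where
  "compactum X \<longleftrightarrow> compact_space X \<and> Hausdorff_space X"

text \<open>
  A binary operation on \<open>[0,1]\<close> is represented by a function on all pairs of reals; its values
  outside the unit square are never constrained and never used.
\<close>

definition t_norm :: "(real \<Rightarrow> real \<Rightarrow> real) \<Rightarrow> bool" where
  "t_norm T \<longleftrightarrow>
     (\<forall>s\<in>{0..1}. \<forall>t\<in>{0..1}. T s t \<in> {0..1}) \<and>
     (\<forall>r\<in>{0..1}. \<forall>s\<in>{0..1}. \<forall>t\<in>{0..1}. T (T r s) t = T r (T s t)) \<and>
     (\<forall>s\<in>{0..1}. \<forall>t\<in>{0..1}. T s t = T t s) \<and>
     (\<forall>s\<in>{0..1}. \<forall>s'\<in>{0..1}. \<forall>t\<in>{0..1}. \<forall>t'\<in>{0..1}.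
        s \<le> s' \<longrightarrow> t \<le> t' \<longrightarrow> T s t \<le> T s' t') \<and>
     (\<forall>s\<in>{0..1}. T s 1 = s)"

definition continuous_t_norm :: "(real \<Rightarrow> real \<Rightarrow> real) \<Rightarrow> bool" where
  "continuous_t_norm T \<longleftrightarrow>
     t_norm T \<and> continuous_on ({0..1} \<times> {0..1}) (\<lambda>(s, t). T s t)"

text \<open>
  Capacities, continuous functions and functionals are extensional (equal to \<open>undefined\<close> off their
  domain), so that they correspond exactly to functions on \<open>\<F>(X)\<close>, \<open>X\<close> and \<open>C(X,[0,1])\<close>.
\<close>

definition capacities :: "'a topology \<Rightarrow> ('a set \<Rightarrow> real) set" where
  "capacities X =
     {\<nu> \<in> {F. closedin X F} \<rightarrow>\<^sub>E {0..1}.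
        \<nu> (topspace X) = 1 \<and> \<nu> {} = 0 \<and>
        (\<forall>F G. closedin X F \<longrightarrow> closedin X G \<longrightarrow> F \<subseteq> G \<longrightarrow> \<nu> F \<le> \<nu> G) \<and>
        (\<forall>F a. closedin X F \<longrightarrow> \<nu> F < a \<longrightarrow>
           (\<exists>U. openin X U \<and> F \<subseteq> U \<and> (\<forall>B. compactin X B \<longrightarrow> B \<subseteq> U \<longrightarrow> \<nu> B < a)))}"

definition subpartition ::
    "'a topology \<Rightarrow> nat \<Rightarrow> (nat \<Rightarrow> real) \<Rightarrow> (nat \<Rightarrow> 'a set) \<Rightarrow> bool" where
  "subpartition X n l A \<longleftrightarrow>
     (\<forall>i\<in>{1..n}. 0 \<le> l i) \<and>
     (\<forall>i\<in>{1..n}. closedin X (A i)) \<and>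
     (\<forall>x\<in>topspace X. (\<Sum>i=1..n. l i * indicat_real (A i) x) \<le> 1)"

definition balanced_capacities :: "'a topology \<Rightarrow> ('a set \<Rightarrow> real) set" where
  "balanced_capacities X =
     {\<nu> \<in> capacities X.
        \<forall>n l A. subpartition X n l A \<longrightarrow> (\<Sum>i=1..n. l i * \<nu> (A i)) \<le> 1}"

definition C01 :: "'a topology \<Rightarrow> ('a \<Rightarrow> real) set" where
  "C01 X = {f \<in> extensional (topspace X). continuous_map X (top_of_set {0..1}) f}"

definition superlevel :: "'a topology \<Rightarrow> ('a \<Rightarrow> real) \<Rightarrow> real \<Rightarrow> 'a set" where
  "superlevel X f t = topspace X \<inter> f -` {t..}"

text \<open>
  The library's \<^const>\<open>Max\<close> is meaningful only for finite sets, so the maximum of the (generally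
  infinite) set of values is expressed by \<^const>\<open>Greatest\<close>.
\<close>

definition t_integral ::
    "(real \<Rightarrow> real \<Rightarrow> real) \<Rightarrow> 'a topology \<Rightarrow> ('a \<Rightarrow> real) \<Rightarrow> ('a set \<Rightarrow> real) \<Rightarrow> real" where
  "t_integral T X f \<nu> = (GREATEST r. r \<in> {T (\<nu> (superlevel X f t)) t | t. t \<in> {0..1}})"

definition comonotone :: "'a topology \<Rightarrow> ('a \<Rightarrow> real) \<Rightarrow> ('a \<Rightarrow> real) \<Rightarrow> bool" where
  "comonotone X \<phi> \<psi> \<longleftrightarrow>
     (\<forall>x1\<in>topspace X. \<forall>x2\<in>topspace X. (\<phi> x1 - \<phi> x2) * (\<psi> x1 - \<psi> x2) \<ge> 0)"

definition t_functionals ::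
    "(real \<Rightarrow> real \<Rightarrow> real) \<Rightarrow> 'a topology \<Rightarrow> (('a \<Rightarrow> real) \<Rightarrow> real) set" where
  "t_functionals T X =
     {\<mu> \<in> C01 X \<rightarrow>\<^sub>E {0..1}.
        \<mu> (\<lambda>x\<in>topspace X. 1) = 1 \<and>
        (\<forall>\<phi>\<in>C01 X. \<forall>\<psi>\<in>C01 X. (\<forall>x\<in>topspace X. \<phi> x \<le> \<psi> x) \<longrightarrow> \<mu> \<phi> \<le> \<mu> \<psi>) \<and>
        (\<forall>\<phi>\<in>C01 X. \<forall>\<psi>\<in>C01 X. comonotone X \<phi> \<psi> \<longrightarrow>
           \<mu> (\<lambda>x\<in>topspace X. max (\<psi> x) (\<phi> x)) = max (\<mu> \<psi>) (\<mu> \<phi>)) \<and>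
        (\<forall>c\<in>{0..1}. \<forall>\<phi>\<in>C01 X. \<mu> (\<lambda>x\<in>topspace X. T c (\<phi> x)) = T c (\<mu> \<phi>))}"

definition balanced_functionals ::
    "(real \<Rightarrow> real \<Rightarrow> real) \<Rightarrow> 'a topology \<Rightarrow> (('a \<Rightarrow> real) \<Rightarrow> real) set" where
  "balanced_functionals T X =
     {\<mu> \<in> t_functionals T X.
        \<forall>n l A. subpartition X n l A \<longrightarrow>
          (\<exists>\<phi>. (\<forall>i\<in>{1..n}. \<phi> i \<in> C01 X \<and> (\<forall>x\<in>topspace X. indicat_real (A i) x \<le> \<phi> i x)) \<and>
               (\<Sum>i=1..n. l i * \<mu> (\<phi> i)) \<le> 1)}"

end

theory Submission
  imports Defs
begin

text \<open>
  The functional \<open>\<mu>\<close> is the integral of the capacity that sends a closed set \<open>F\<close> to the infimum of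
  \<open>\<mu> \<phi>\<close> over the \<open>\<phi>\<close> equal to \<open>1\<close> on \<open>F\<close>. Composing \<open>\<phi>\<close> with a ramp that is \<open>1\<close> above \<open>t\<close> and
  the identity below \<open>c < t\<close> gives a function whose \<open>T\<close>-product with \<open>c\<close> is at most \<open>\<phi>\<close>; this yields
  both the upper semicontinuity of the capacity and the upper bound on its integral. The lower bound
  follows by comparing \<open>\<phi>\<close> with comonotone maxima of ramps in \<open>\<phi>\<close>. Balancedness passes from \<open>\<mu>\<close> to
  the infimum directly. Conversely, the closed sets of a subpartition can be thickened to closed sets
  \<open>B i\<close> that still form a subpartition; functions supported in \<open>B i\<close> have integral at most \<open>\<nu> (B i)\<close>.
\<close>

section \<open>Closed level sets and continuous functions into the unit interval\<close>

text \<open>The sum at \<open>x\<close> is the total weight of the indices \<open>i\<close> with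
  \<open>x \<in> A i\<close>. Hence the set is a finite union, over index sets \<open>J\<close> of
  weight above \<open>c\<close>, of intersections of the \<open>A i\<close>; non-negative weights
  ensure that further indices only increase the sum.\<close>

lemma sum_subpartition_closedin:
  fixes l :: "'i \<Rightarrow> real"
  assumes "finite I" and "\<And>i. i \<in> I \<Longrightarrow> 0 \<le> l i" and "\<And>i. i \<in> I \<Longrightarrow> closedin X (A i)"
  shows "closedin X {x \<in> topspace X. c < (\<Sum>i\<in>I. l i * indicat_real (A i) x)}"
proof -
  define \<J> where "\<J> = {J. J \<subseteq> I \<and> c < sum l J}"
  have "{x \<in> topspace X. c < (\<Sum>i\<in>I. l i * indicat_real (A i) x)} =
      (\<Union>J\<in>\<J>. {x \<in> topspace X. \<forall>i\<in>J. x \<in> A i})"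
  proof (intro equalityI subsetI)
    fix x assume x: "x \<in> {x \<in> topspace X. c < (\<Sum>i\<in>I. l i * indicat_real (A i) x)}"
    have "(\<Sum>i\<in>I. l i * indicat_real (A i) x) = (\<Sum>i\<in>I. if x \<in> A i then l i else 0)"
      by (intro sum.cong) (auto simp: indicator_def)
    also have "\<dots> = sum l {i \<in> I. x \<in> A i}"
      by (rule sum.inter_filter[symmetric, OF assms(1)])
    finally have "{i \<in> I. x \<in> A i} \<in> \<J>" using x by (auto simp: \<J>_def)
    then show "x \<in> (\<Union>J\<in>\<J>. {x \<in> topspace X. \<forall>i\<in>J. x \<in> A i})" using x by blast
  next
    fix x assume "x \<in> (\<Union>J\<in>\<J>. {x \<in> topspace X. \<forall>i\<in>J. x \<in> A i})"
    then obtain J where J: "J \<subseteq> I" "c < sum l J" and x: "x \<in> topspace X" "\<forall>i\<in>J. x \<in> A i"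
      by (auto simp: \<J>_def)
    have "sum l J = (\<Sum>i\<in>J. l i * indicat_real (A i) x)" using x by simp
    also have "\<dots> \<le> (\<Sum>i\<in>I. l i * indicat_real (A i) x)"
      by (rule sum_mono2) (use J assms in \<open>auto simp: indicator_def\<close>)
    finally show "x \<in> {x \<in> topspace X. c < (\<Sum>i\<in>I. l i * indicat_real (A i) x)}"
      using J x by simp
  qed
  moreover have "finite \<J>" using assms(1) by (simp add: \<J>_def)
  moreover have "closedin X {x \<in> topspace X. \<forall>i\<in>J. x \<in> A i}" if "J \<in> \<J>" for J
  \<comment> \<open>The empty \<open>J\<close> occurs when \<open>c < 0\<close>; its piece is then
    the whole space.\<close>
  proof (cases "J = {}")
    case False
    have "{x \<in> topspace X. \<forall>i\<in>J. x \<in> A i} = (\<Inter>i\<in>J. A i)"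
      using that False assms(3) by (fastforce simp: \<J>_def dest: closedin_subset)
    then show ?thesis using False that assms(3) by (auto simp: \<J>_def intro!: closedin_INT)
  qed simp
  ultimately show ?thesis by (auto intro!: closedin_Union)
qed

lemma C01_range: "\<phi> \<in> C01 X \<Longrightarrow> x \<in> topspace X \<Longrightarrow> \<phi> x \<in> {0..1}"
  by (auto simp: C01_def continuous_map_in_subtopology)

lemma C01_compose:
  assumes "\<phi> \<in> C01 X" and "continuous_on {0..1} h" and "h ` {0..1} \<subseteq> {0..1}"
  shows "(\<lambda>x\<in>topspace X. h (\<phi> x)) \<in> C01 X"
proof -
  have "continuous_map X (top_of_set {0..1}) \<phi>" using assms(1) by (simp add: C01_def)
  moreover have "continuous_map (top_of_set {0..1}) (top_of_set {0..1}) h"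
    using assms(2,3) by (auto simp: continuous_map_in_subtopology)
  ultimately have "continuous_map X (top_of_set {0..1}) (h \<circ> \<phi>)" by (rule continuous_map_compose)
  then have "continuous_map X (top_of_set {0..1}) (\<lambda>x\<in>topspace X. h (\<phi> x))"
    by (rule continuous_map_eq) simp
  then show ?thesis by (simp add: C01_def)
qed

lemma superlevel_closedin:
  assumes "\<phi> \<in> C01 X"
  shows "closedin X (superlevel X \<phi> t)"
proof -
  have "continuous_map X euclideanreal \<phi>"
    using assms by (simp add: C01_def continuous_map_in_subtopology)
  then have "closedin X {x \<in> topspace X. \<phi> x \<in> {t..}}"
    by (rule closedin_continuous_map_preimage) simp
  moreover have "{x \<in> topspace X. \<phi> x \<in> {t..}} = superlevel X \<phi> t"
    by (auto simp: superlevel_def)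
  ultimately show ?thesis by simp
qed

text \<open>On the compact complement of \<open>U\<close> the function attains a maximum, which lies
  below \<open>t\<close>; half of the gap serves as \<open>d\<close>.\<close>

lemma superlevel_subset_openin:
  assumes "compact_space X" and "\<phi> \<in> C01 X" and "openin X U" and "superlevel X \<phi> t \<subseteq> U"
  shows "\<exists>d>0. superlevel X \<phi> (t - d) \<subseteq> U"
proof (cases "topspace X - U = {}")
  case True
  then show ?thesis by (intro exI[of _ 1]) (auto simp: superlevel_def)
next
  case False
  have "closedin X (topspace X - U)" using assms(3) by blast
  then have "compactin X (topspace X - U)" using assms(1) by (simp add: closedin_compact_space)
  moreover have "continuous_map X euclideanreal \<phi>"
    using assms(2) by (simp add: C01_def continuous_map_in_subtopology)
  ultimately have "compact (\<phi> ` (topspace X - U))" using image_compactin by fastforce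
  then obtain y where y: "y \<in> topspace X - U" "\<And>x. x \<in> topspace X - U \<Longrightarrow> \<phi> x \<le> \<phi> y"
    using compact_attains_sup[of "\<phi> ` (topspace X - U)"] False by auto
  have "\<phi> y < t" using y(1) assms(4) by (force simp: superlevel_def)
  then have "superlevel X \<phi> (t - (t - \<phi> y) / 2) \<subseteq> U"
    using y(2) by (force simp: superlevel_def field_simps)
  then show ?thesis using \<open>\<phi> y < t\<close> by (intro exI[of _ "(t - \<phi> y) / 2"]) auto
qed

section \<open>Separation of closed sets and thickening of subpartitions\<close>

text \<open>For a Urysohn function \<open>g\<close> that is 0 on \<open>S\<close> and 1 on
  \<open>F\<close>, the ramp \<open>max 0 (2 * g - 1)\<close> vanishes outside the closed set where
  \<open>g\<close> is at least 1/2, and that set still misses \<open>S\<close>.\<close>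

lemma closedin_indicator_separation:
  assumes "compactum X" and "closedin X F" and "closedin X S" and "F \<inter> S = {}"
  obtains \<phi> B where "\<phi> \<in> C01 X" and "closedin X B" and "F \<subseteq> B" and "B \<inter> S = {}"
    and "\<And>x. x \<in> F \<Longrightarrow> \<phi> x = 1" and "\<And>x. x \<in> topspace X - B \<Longrightarrow> \<phi> x = 0"
proof -
  have "normal_space X"
    using assms(1) by (auto simp: compactum_def intro: compact_Hausdorff_or_regular_imp_normal_space)
  then obtain f where f: "continuous_map X (top_of_set {0..1::real}) f" "f ` S \<subseteq> {0}" "f ` F \<subseteq> {1}"
    using Urysohn_lemma[of X S F 0 1] assms by (auto simp: disjnt_def)
  define g where "g = restrict f (topspace X)"
  have F: "F \<subseteq> topspace X" using assms(2) by (rule closedin_subset)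
  have "continuous_map X (top_of_set {0..1}) g"
    using f(1) by (rule continuous_map_eq) (simp add: g_def)
  then have g: "g \<in> C01 X" by (simp add: C01_def g_def)
  define \<phi> where "\<phi> = (\<lambda>x\<in>topspace X. max 0 (2 * g x - 1))"
  define B where "B = superlevel X g (1/2)"
  show thesis
  proof
    show "\<phi> \<in> C01 X"
      unfolding \<phi>_def by (rule C01_compose[OF g]) (auto intro!: continuous_intros)
    show "closedin X B" unfolding B_def by (rule superlevel_closedin[OF g])
    show "F \<subseteq> B" using f(3) F by (force simp: B_def superlevel_def g_def)
    show "B \<inter> S = {}" using f(2) by (force simp: B_def superlevel_def g_def)
    show "\<phi> x = 1" if "x \<in> F" for x using f(3) F that by (force simp: \<phi>_def g_def)
    show "\<phi> x = 0" if "x \<in> topspace X - B" for x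
      using that by (auto simp: \<phi>_def B_def superlevel_def)
  qed
qed

text \<open>The points where the remaining weights exceed \<open>1 - l k\<close> form a closed set
  \<open>S\<close> disjoint from \<open>A k\<close>. Any closed \<open>B\<close> that misses
  \<open>S\<close> can replace \<open>A k\<close> without breaking the inequality.\<close>

lemma subpartition_enlarge:
  assumes "compactum X" and "subpartition X n l A" and "k \<in> {1..n}"
  obtains \<phi> B where "\<phi> \<in> C01 X" and "closedin X B" and "subpartition X n l (A(k := B))"
    and "\<And>x. x \<in> A k \<Longrightarrow> \<phi> x = 1" and "\<And>x. x \<in> topspace X - B \<Longrightarrow> \<phi> x = 0"
proof -
  define rest where "rest x = (\<Sum>i\<in>{1..n} - {k}. l i * indicat_real (A i) x)" for x
  define S where "S = {x \<in> topspace X. 1 - l k < rest x}"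
  \<comment> \<open>With \<open>C\<close> left free, the same identity serves the old family
    (\<open>C = A k\<close>) and the new one (\<open>C = B\<close>).\<close>
  have split: "(\<Sum>i=1..n. l i * indicat_real ((A(k := C)) i) x) = l k * indicat_real C x + rest x"
    for C x
    unfolding rest_def using assms(3) by (subst sum.remove[of _ k]) auto
  have l: "\<And>i. i \<in> {1..n} \<Longrightarrow> 0 \<le> l i" and A: "\<And>i. i \<in> {1..n} \<Longrightarrow> closedin X (A i)"
    and le: "\<And>x. x \<in> topspace X \<Longrightarrow> l k * indicat_real (A k) x + rest x \<le> 1"
    using assms(2) split[of "A k"] by (auto simp: subpartition_def)
  have "closedin X S"
    unfolding S_def rest_def by (rule sum_subpartition_closedin) (use l A in auto)
  moreover have "A k \<inter> S = {}" using le by (fastforce simp: S_def)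
  ultimately obtain \<phi> B where *: "\<phi> \<in> C01 X" "closedin X B" "A k \<subseteq> B" "B \<inter> S = {}"
    "\<And>x. x \<in> A k \<Longrightarrow> \<phi> x = 1" "\<And>x. x \<in> topspace X - B \<Longrightarrow> \<phi> x = 0"
    using closedin_indicator_separation[OF assms(1) A[OF assms(3)]] by metis
  have "l k * indicat_real B x + rest x \<le> 1" if x: "x \<in> topspace X" for x
  proof (cases "x \<in> B")
    case True
    then show ?thesis using *(4) x by (force simp: S_def)
  next
    case False
    then show ?thesis using le[OF x] mult_nonneg_nonneg[OF l[OF assms(3)], of "indicat_real (A k) x"] by simp
  qed
  then have "subpartition X n l (A(k := B))"
    unfolding subpartition_def split using l A *(2) by auto
  with * show thesis using that by blast
qed

text \<open>A neighbourhood of each \<open>A i\<close> can be added without violating the subpartition inequality,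
  because the sum of the weighted indicators takes finitely many values on closed pieces.\<close>

lemma subpartition_thicken:
  assumes "compactum X" and "subpartition X n l A"
  obtains \<phi> B where "subpartition X n l B"
    and "\<And>i. i \<in> {1..n} \<Longrightarrow> \<phi> i \<in> C01 X"
    and "\<And>i x. i \<in> {1..n} \<Longrightarrow> x \<in> A i \<Longrightarrow> \<phi> i x = 1"
    and "\<And>i x. i \<in> {1..n} \<Longrightarrow> x \<in> topspace X - B i \<Longrightarrow> \<phi> i x = 0"
proof -
  \<comment> \<open>The sets are replaced one at a time. Keeping \<open>B i = A i\<close> for
    \<open>i > k\<close> guarantees that the next function is 1 on the original
    \<open>A (Suc k)\<close>.\<close>
  have "\<exists>\<phi> B. subpartition X n l B \<and> (\<forall>i. k < i \<longrightarrow> B i = A i) \<and>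
      (\<forall>i\<in>{1..k}. \<phi> i \<in> C01 X \<and> (\<forall>x\<in>A i. \<phi> i x = 1) \<and> (\<forall>x\<in>topspace X - B i. \<phi> i x = 0))"
    if "k \<le> n" for k
    using that
  proof (induction k)
    case 0
    then show ?case using assms(2) by (intro exI[of _ A] exI) auto
  next
    case (Suc k)
    then obtain \<phi> B where IH: "subpartition X n l B" "\<forall>i. k < i \<longrightarrow> B i = A i"
      "\<forall>i\<in>{1..k}. \<phi> i \<in> C01 X \<and> (\<forall>x\<in>A i. \<phi> i x = 1) \<and> (\<forall>x\<in>topspace X - B i. \<phi> i x = 0)"
      by auto
    obtain \<psi> C where "\<psi> \<in> C01 X" "closedin X C" "subpartition X n l (B(Suc k := C))"
      "\<And>x. x \<in> B (Suc k) \<Longrightarrow> \<psi> x = 1" "\<And>x. x \<in> topspace X - C \<Longrightarrow> \<psi> x = 0"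
      using subpartition_enlarge[OF assms(1) IH(1), of "Suc k"] Suc.prems by auto
    then show ?case using IH(2,3)
      by (intro exI[of _ "\<phi>(Suc k := \<psi>)"] exI[of _ "B(Suc k := C)"]) (auto simp: le_Suc_eq simp flip: fun_upd_def)
  qed
  from this[of n] show thesis using that by (metis order_refl)
qed

section \<open>Continuous t-norms on the unit interval\<close>

locale continuous_t_norm_compactum =
  fixes T :: "real \<Rightarrow> real \<Rightarrow> real" and X :: "'a topology"
  assumes cont: "continuous_t_norm T" and compactum: "compactum X"
begin

lemma T_closed: "s \<in> {0..1} \<Longrightarrow> t \<in> {0..1} \<Longrightarrow> T s t \<in> {0..1}"
  using cont unfolding continuous_t_norm_def t_norm_def by blast

lemma T_commute: "s \<in> {0..1} \<Longrightarrow> t \<in> {0..1} \<Longrightarrow> T s t = T t s"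
  using cont unfolding continuous_t_norm_def t_norm_def by blast

lemma T_mono:
  "s \<in> {0..1} \<Longrightarrow> s' \<in> {0..1} \<Longrightarrow> t \<in> {0..1} \<Longrightarrow> t' \<in> {0..1} \<Longrightarrow> s \<le> s' \<Longrightarrow> t \<le> t' \<Longrightarrow>
    T s t \<le> T s' t'"
  using cont unfolding continuous_t_norm_def t_norm_def by blast

lemma T_one: "s \<in> {0..1} \<Longrightarrow> T s 1 = s"
  using cont unfolding continuous_t_norm_def t_norm_def by blast

lemma one_T: "s \<in> {0..1} \<Longrightarrow> T 1 s = s"
  using T_commute[of 1 s] T_one[of s] by simp

lemma T_le_left: "s \<in> {0..1} \<Longrightarrow> t \<in> {0..1} \<Longrightarrow> T s t \<le> s"
  using T_mono[of s s t 1] T_one[of s] by simp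

lemma T_le_right: "s \<in> {0..1} \<Longrightarrow> t \<in> {0..1} \<Longrightarrow> T s t \<le> t"
  using T_mono[of s 1 t t] one_T[of t] by simp

lemma T_zero: "s \<in> {0..1} \<Longrightarrow> T s 0 = 0"
  using T_le_right[of s 0] T_closed[of s 0] by simp

lemma T_continuous_right: "c \<in> {0..1} \<Longrightarrow> continuous_on {0..1} (T c)"
proof -
  assume c: "c \<in> {0..1}"
  have "continuous_on {0..1} ((\<lambda>(s, t). T s t) \<circ> Pair c)"
  proof (rule continuous_on_compose)
    show "continuous_on (Pair c ` {0..1}) (\<lambda>(s, t). T s t)"
      using cont c unfolding continuous_t_norm_def
      by (elim conjE continuous_on_subset) auto
  qed (intro continuous_intros)
  then show ?thesis by (simp add: comp_def)
qed

text \<open>Joint continuity controls only points near \<open>(s, t)\<close>. Replacing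
  \<open>s'\<close> and \<open>t'\<close> by \<open>max s s'\<close> and \<open>max t t'\<close> and
  using monotonicity removes any lower bound on them.\<close>

lemma T_less_nbhd:
  assumes "s \<in> {0..1}" and "t \<in> {0..1}" and "T s t < m"
  shows "\<exists>e>0. \<forall>s'\<in>{0..1}. \<forall>t'\<in>{0..1}. s' < s + e \<longrightarrow> t' < t + e \<longrightarrow> T s' t' < m"
proof -
  have "continuous_on ({0..1} \<times> {0..1}) (\<lambda>(s, t). T s t)"
    using cont by (simp add: continuous_t_norm_def)
  then obtain d where d: "d > 0"
    "\<And>y. y \<in> {0..1} \<times> {0..1} \<Longrightarrow> dist y (s, t) < d \<Longrightarrow> dist (case y of (s, t) \<Rightarrow> T s t) (T s t) < m - T s t"
    unfolding continuous_on_iff using assms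
    by (metis (no_types, lifting) SigmaI case_prod_conv diff_gt_0_iff_gt)
  have "T s' t' < m" if "s' \<in> {0..1}" "t' \<in> {0..1}" "s' < s + d / 2" "t' < t + d / 2" for s' t'
  proof -
    have "dist (max s s', max t t') (s, t) \<le> \<bar>max s s' - s\<bar> + \<bar>max t t' - t\<bar>"
      using sqrt_sum_squares_le_sum_abs by (simp only: dist_Pair_Pair dist_real_def power2_abs)
    also have "\<dots> < d" using that d(1) by (auto simp: max_def)
    finally have "dist (T (max s s') (max t t')) (T s t) < m - T s t"
      using d(2)[of "(max s s', max t t')"] assms that by (auto simp: le_max_iff_disj)
    moreover have "T s' t' \<le> T (max s s') (max t t')"
      by (rule T_mono) (use that assms in auto)
    ultimately show ?thesis by (simp add: dist_real_def)
  qed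
  then show ?thesis using d(1) by (intro exI[of _ "d / 2"]) auto
qed

text \<open>Left continuity in the first argument; positivity of \<open>s\<close> leaves room for a
  non-negative \<open>c\<close> below it.\<close>

lemma T_greater_left:
  assumes "s \<in> {0<..1}" and "t \<in> {0..1}" and "m < T s t"
  obtains c where "0 \<le> c" and "c < s" and "m < T c t"
proof -
  have s: "s \<in> {0..1}" using assms(1) by auto
  have "continuous_on {0..1} (T t)" using assms(2) by (rule T_continuous_right)
  moreover have "T t s - m > 0" using assms s T_commute by auto
  ultimately obtain d where d: "d > 0"
    "\<And>c. c \<in> {0..1} \<Longrightarrow> dist c s < d \<Longrightarrow> dist (T t c) (T t s) < T t s - m"
    unfolding continuous_on_iff using s by (metis (no_types, lifting))
  define c where "c = max 0 (s - d / 2)"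
  have c: "0 \<le> c" "c < s" "c \<in> {0..1}" "dist c s < d"
    using d(1) assms(1) by (auto simp: c_def dist_real_def max_def)
  then have "dist (T t c) (T t s) < T t s - m" using d(2) by blast
  then have "m < T t c" by (simp add: dist_real_def)
  then have "m < T c t" using T_commute[OF assms(2) c(3)] by simp
  with c show thesis using that by blast
qed

section \<open>Capacities and attainment of the maximum in the t-normed integral\<close>

lemma capacity_range: "\<nu> \<in> capacities X \<Longrightarrow> closedin X F \<Longrightarrow> \<nu> F \<in> {0..1}"
  by (auto simp: capacities_def)

lemma capacity_mono:
  "\<nu> \<in> capacities X \<Longrightarrow> closedin X F \<Longrightarrow> closedin X G \<Longrightarrow> F \<subseteq> G \<Longrightarrow> \<nu> F \<le> \<nu> G"
  by (auto simp: capacities_def)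

lemma capacity_upper_semicontinuous:
  assumes "\<nu> \<in> capacities X" and "closedin X F" and "\<nu> F < a"
  obtains U where "openin X U" and "F \<subseteq> U"
    and "\<And>B. compactin X B \<Longrightarrow> B \<subseteq> U \<Longrightarrow> \<nu> B < a"
proof -
  have "\<exists>U. openin X U \<and> F \<subseteq> U \<and> (\<forall>B. compactin X B \<longrightarrow> B \<subseteq> U \<longrightarrow> \<nu> B < a)"
    using assms unfolding capacities_def by blast
  with that show thesis by blast
qed

text \<open>Upper semicontinuity of \<open>\<nu>\<close> and compactness keep the capacity of
  slightly larger superlevel sets small, and \<open>T_less_nbhd\<close> absorbs the change. The set
  level \<open>r\<close> and the factor \<open>u\<close> vary independently, as the truncation
  argument requires; \<open>r\<close> has no upper bound because superlevel sets shrink as it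
  grows.\<close>

lemma integrand_less_nbhd:
  assumes "\<nu> \<in> capacities X" and "\<phi> \<in> C01 X" and "t \<in> {0..1}"
    and "T (\<nu> (superlevel X \<phi> t)) t < m"
  shows "\<exists>d>0. \<forall>r>t - d. \<forall>u\<in>{0..1}. u < t + d \<longrightarrow> T (\<nu> (superlevel X \<phi> r)) u < m"
proof -
  let ?F = "superlevel X \<phi>"
  note F = superlevel_closedin[OF assms(2)]
  obtain e where e: "e > 0"
    "\<And>s' t'. s' \<in> {0..1} \<Longrightarrow> t' \<in> {0..1} \<Longrightarrow> s' < \<nu> (?F t) + e \<Longrightarrow> t' < t + e \<Longrightarrow> T s' t' < m"
    using T_less_nbhd[OF capacity_range[OF assms(1) F] assms(3,4)] by blast
  obtain U where U: "openin X U" "?F t \<subseteq> U"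
    "\<And>B. compactin X B \<Longrightarrow> B \<subseteq> U \<Longrightarrow> \<nu> B < \<nu> (?F t) + e"
    using capacity_upper_semicontinuous[OF assms(1) F, of t "\<nu> (?F t) + e"] e(1) by auto
  obtain d where d: "d > 0" "?F (t - d) \<subseteq> U"
    using superlevel_subset_openin[OF _ assms(2) U(1,2)] compactum by (auto simp: compactum_def)
  have "T (\<nu> (?F r)) u < m" if "r > t - min d e" "u \<in> {0..1}" "u < t + min d e" for r u
  proof (rule e(2))
    have "?F r \<subseteq> ?F (t - d)" using that(1) by (auto simp: superlevel_def)
    then show "\<nu> (?F r) < \<nu> (?F t) + e"
      using U(3)[of "?F r"] d(2) F[of r] compactum
      by (auto simp: compactum_def closedin_compact_space)
  qed (use that capacity_range[OF assms(1) F] in auto)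
  then show ?thesis using d(1) e(1) by (intro exI[of _ "min d e"]) auto
qed

text \<open>The integrand is upper semicontinuous in \<open>t\<close>, so it attains its supremum on
  \<open>{0..1}\<close>. Only this makes the \<open>GREATEST\<close> in \<open>t_integral\<close>
  meaningful.\<close>

lemma t_integral_attained:
  assumes "\<nu> \<in> capacities X" and "\<phi> \<in> C01 X"
  obtains t where "t \<in> {0..1}" and "t_integral T X \<phi> \<nu> = T (\<nu> (superlevel X \<phi> t)) t"
proof -
  let ?g = "\<lambda>t. T (\<nu> (superlevel X \<phi> t)) t"
  note F = superlevel_closedin[OF assms(2)]
  have g1: "?g t \<in> {0..1}" if "t \<in> {0..1}" for t
    by (rule T_closed[OF capacity_range[OF assms(1) F] that])
  have bdd: "bdd_above (?g ` {0..1})" using g1 by (intro bdd_aboveI[of _ 1]) auto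
  define M where "M = (SUP t\<in>{0..1}. ?g t)"
  have le: "?g t \<le> M" if "t \<in> {0..1}" for t
    unfolding M_def using bdd that by (intro cSUP_upper) auto
  have "\<exists>t\<in>{0..1}. ?g t = M"
  proof (rule ccontr)
    assume "\<not> ?thesis"
    with le have less: "?g t < M" if "t \<in> {0..1}" for t using that by fastforce
    \<comment> \<open>A uniform bound strictly below the supremum exists locally and survives
      joining adjacent intervals, so bisection extends it to \<open>{0..1}\<close>, which is
      absurd.\<close>
    define P where "P s u = (\<exists>b<M. \<forall>t\<in>{s..u} \<inter> {0..1}. ?g t \<le> b)" for s u
    have "P 0 1"
    proof (rule Bolzano)
      fix a b c assume "P a b" "P b c" "a \<le> b" "b \<le> c"
      then obtain b1 b2 where "b1 < M" "b2 < M" "\<forall>t\<in>{a..b} \<inter> {0..1}. ?g t \<le> b1"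
        "\<forall>t\<in>{b..c} \<inter> {0..1}. ?g t \<le> b2" by (auto simp: P_def)
      then show "P a c"
        unfolding P_def by (intro exI[of _ "max b1 b2"]) (fastforce simp: le_max_iff_disj)
    next
      fix x :: real assume "0 \<le> x" "x \<le> 1"
      then have x: "x \<in> {0..1}" by simp
      define b where "b = (?g x + M) / 2"
      have b: "?g x < b" "b < M" using less[OF x] by (auto simp: b_def)
      obtain d where "d > 0"
        and d: "\<And>r u. r > x - d \<Longrightarrow> u \<in> {0..1} \<Longrightarrow> u < x + d \<Longrightarrow> T (\<nu> (superlevel X \<phi> r)) u < b"
        using integrand_less_nbhd[OF assms x b(1)] by blast
      have "P s u" if "s \<le> x \<and> x \<le> u \<and> u - s < d" for s u
        unfolding P_def
      proof (intro exI[of _ b] conjI ballI)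
        fix t assume "t \<in> {s..u} \<inter> {0..1}"
        then show "?g t \<le> b" using d[of t t] that by force
      qed (rule b(2))
      with \<open>d > 0\<close> show "\<exists>d>0. \<forall>s u. s \<le> x \<and> x \<le> u \<and> u - s < d \<longrightarrow> P s u" by blast
    qed simp
    then obtain b where "b < M" "\<forall>t\<in>{0..1}. ?g t \<le> b" by (auto simp: P_def)
    moreover from this have "M \<le> b" unfolding M_def by (intro cSUP_least) auto
    ultimately show False by simp
  qed
  then obtain t where t: "t \<in> {0..1}" "?g t = M" by blast
  have "t_integral T X \<phi> \<nu> = M"
    unfolding t_integral_def by (rule Greatest_equality) (use t le in auto)
  with t show thesis using that by simp
qed

text \<open>At a positive level the superlevel set lies in \<open>B\<close>, and \<open>T\<close>
  never exceeds its left argument. At level 0 the superlevel set is the whole space, but the factor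
  0 makes the value 0.\<close>

lemma t_integral_le_capacity:
  assumes "\<nu> \<in> capacities X" and "\<phi> \<in> C01 X" and "closedin X B"
    and "\<And>x. x \<in> topspace X - B \<Longrightarrow> \<phi> x = 0"
  shows "t_integral T X \<phi> \<nu> \<le> \<nu> B"
proof -
  let ?F = "superlevel X \<phi>"
  note F = superlevel_closedin[OF assms(2)]
  obtain t where t: "t \<in> {0..1}" "t_integral T X \<phi> \<nu> = T (\<nu> (?F t)) t"
    using t_integral_attained[OF assms(1,2)] .
  show ?thesis
  proof (cases "t = 0")
    case True
    then show ?thesis
      using t T_zero[OF capacity_range[OF assms(1) F]] capacity_range[OF assms(1,3)] by simp
  next
    case False
    then have "?F t \<subseteq> B" using assms(4) t(1) by (force simp: superlevel_def)
    then show ?thesis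
      using t T_le_left[OF capacity_range[OF assms(1) F] t(1), of t]
        capacity_mono[OF assms(1) F assms(3), of t] by simp
  qed
qed

end

section \<open>Functionals and their induced capacities\<close>

locale t_functional = continuous_t_norm_compactum +
  fixes \<mu> :: "('a \<Rightarrow> real) \<Rightarrow> real"
  assumes functional: "\<mu> \<in> t_functionals T X"
begin

lemma \<mu>_range: "\<phi> \<in> C01 X \<Longrightarrow> \<mu> \<phi> \<in> {0..1}"
  using functional by (auto simp: t_functionals_def)

lemma \<mu>_one: "\<mu> (\<lambda>x\<in>topspace X. 1) = 1"
  using functional by (simp add: t_functionals_def)

lemma \<mu>_mono:
  "\<phi> \<in> C01 X \<Longrightarrow> \<psi> \<in> C01 X \<Longrightarrow> (\<And>x. x \<in> topspace X \<Longrightarrow> \<phi> x \<le> \<psi> x) \<Longrightarrow> \<mu> \<phi> \<le> \<mu> \<psi>"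
  using functional by (simp add: t_functionals_def)

lemma \<mu>_max:
  "\<phi> \<in> C01 X \<Longrightarrow> \<psi> \<in> C01 X \<Longrightarrow> comonotone X \<phi> \<psi> \<Longrightarrow>
    \<mu> (\<lambda>x\<in>topspace X. max (\<psi> x) (\<phi> x)) = max (\<mu> \<psi>) (\<mu> \<phi>)"
  using functional by (simp add: t_functionals_def)

lemma \<mu>_T: "c \<in> {0..1} \<Longrightarrow> \<phi> \<in> C01 X \<Longrightarrow> \<mu> (\<lambda>x\<in>topspace X. T c (\<phi> x)) = T c (\<mu> \<phi>)"
  using functional by (simp add: t_functionals_def)

lemma const_C01: "c \<in> {0..1} \<Longrightarrow> (\<lambda>x\<in>topspace X. c) \<in> C01 X"
  by (auto simp: C01_def continuous_map_in_subtopology intro: continuous_map_eq[of _ _ "\<lambda>_. c"])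

lemma \<mu>_zero: "\<mu> (\<lambda>x\<in>topspace X. 0) = 0"
proof -
  have "\<mu> (\<lambda>x\<in>topspace X. T 0 ((\<lambda>x\<in>topspace X. 1) x)) = T 0 1"
    using \<mu>_T[of 0 "\<lambda>x\<in>topspace X. 1"] const_C01[of 1] \<mu>_one by simp
  moreover have "(\<lambda>x\<in>topspace X. T 0 ((\<lambda>x\<in>topspace X. 1) x)) = (\<lambda>x\<in>topspace X. 0)"
    using T_one[of 0] by auto
  ultimately show ?thesis using T_one[of 0] by simp
qed

text \<open>For functions into \<open>{0..1}\<close>, being 1 on \<open>F\<close> is the same as
  dominating the indicator of \<open>F\<close>, which is the condition in the definition of balanced
  functionals.\<close>

definition induced :: "'a set \<Rightarrow> real" where
  "induced = (\<lambda>F\<in>{F. closedin X F}. INF \<phi>\<in>{\<phi> \<in> C01 X. \<forall>x\<in>F. \<phi> x = 1}. \<mu> \<phi>)"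

lemma induced_le:
  assumes "closedin X F" and "\<phi> \<in> C01 X" and "\<And>x. x \<in> F \<Longrightarrow> \<phi> x = 1"
  shows "induced F \<le> \<mu> \<phi>"
proof -
  have "bdd_below (\<mu> ` {\<phi> \<in> C01 X. \<forall>x\<in>F. \<phi> x = 1})"
    using \<mu>_range by (intro bdd_belowI[of _ 0]) auto
  then show ?thesis unfolding induced_def using assms by (auto intro!: cINF_lower)
qed

lemma induced_nonempty: "closedin X F \<Longrightarrow> (\<lambda>x\<in>topspace X. 1) \<in> {\<phi> \<in> C01 X. \<forall>x\<in>F. \<phi> x = 1}"
  using const_C01[of 1] by (auto dest: closedin_subset)

lemma induced_greatest:
  assumes "closedin X F" and "\<And>\<phi>. \<phi> \<in> C01 X \<Longrightarrow> \<forall>x\<in>F. \<phi> x = 1 \<Longrightarrow> m \<le> \<mu> \<phi>"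
  shows "m \<le> induced F"
proof -
  have "m \<le> (INF \<phi>\<in>{\<phi> \<in> C01 X. \<forall>x\<in>F. \<phi> x = 1}. \<mu> \<phi>)"
    using induced_nonempty[OF assms(1)] assms(2) by (intro cINF_greatest) blast+
  then show ?thesis using assms(1) by (simp add: induced_def)
qed

lemma induced_less:
  assumes "closedin X F" and "induced F < a"
  obtains \<phi> where "\<phi> \<in> C01 X" and "\<forall>x\<in>F. \<phi> x = 1" and "\<mu> \<phi> < a"
  using induced_greatest[OF assms(1), of a] assms(2) by force

lemma induced_range: "closedin X F \<Longrightarrow> induced F \<in> {0..1}"
proof -
  assume F: "closedin X F"
  have "induced F \<le> 1" using induced_le[OF F, of "\<lambda>x\<in>topspace X. 1"] induced_nonempty[OF F] \<mu>_one by simp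
  moreover have "0 \<le> induced F" using induced_greatest[OF F] \<mu>_range by auto
  ultimately show ?thesis by simp
qed

text \<open>The function \<open>\<psi>\<close> is 1 on \<open>B\<close>, and
  \<open>T c \<psi> \<le> \<phi>\<close>: where \<open>\<phi> \<le> c\<close>, \<open>\<psi>\<close>
  equals \<open>\<phi>\<close>; elsewhere the product is at most \<open>c\<close>. Homogeneity of
  \<open>\<mu>\<close> then gives the bound.\<close>

lemma T_superlevel_le_strict:
  assumes "\<phi> \<in> C01 X" and "0 \<le> c" and "c < t" and "t \<le> 1" and "closedin X B"
    and "B \<subseteq> superlevel X \<phi> t"
  shows "T c (induced B) \<le> \<mu> \<phi>"
proof -
  \<comment> \<open>On \<open>{0..1}\<close> this is the identity up to \<open>c\<close> and 1 from
    \<open>t\<close> on; the gap \<open>c < t\<close> makes it continuous.\<close>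
  define h where "h v = max v (min 1 ((v - c) / (t - c)))" for v
  define \<psi> where "\<psi> = (\<lambda>x\<in>topspace X. h (\<phi> x))"
  have c: "c \<in> {0..1}" using assms by auto
  have h01: "h v \<in> {0..1}" if "v \<in> {0..1}" for v using that by (auto simp: h_def)
  have \<psi>: "\<psi> \<in> C01 X" unfolding \<psi>_def
  proof (rule C01_compose[OF assms(1)])
    show "continuous_on {0..1} h" unfolding h_def using assms(3) by (auto intro!: continuous_intros)
  qed (use h01 in blast)
  have "\<psi> x = 1" if "x \<in> B" for x
  proof -
    have x: "x \<in> topspace X" "t \<le> \<phi> x" using that assms(6) by (auto simp: superlevel_def)
    then have "1 \<le> (\<phi> x - c) / (t - c)" using assms(3) by (simp add: field_simps)
    then show ?thesis using C01_range[OF assms(1) x(1)] x by (simp add: \<psi>_def h_def)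
  qed
  then have "T c (induced B) \<le> T c (\<mu> \<psi>)"
    using induced_le[OF assms(5) \<psi>] induced_range[OF assms(5)] \<mu>_range[OF \<psi>] c by (intro T_mono) auto
  also have "\<dots> = \<mu> (\<lambda>x\<in>topspace X. T c (\<psi> x))" using \<mu>_T[OF c \<psi>] by simp
  also have "\<dots> \<le> \<mu> \<phi>"
  proof (rule \<mu>_mono)
    show "(\<lambda>x\<in>topspace X. T c (\<psi> x)) \<in> C01 X"
      using T_closed[OF c] by (intro C01_compose[OF \<psi>] T_continuous_right[OF c]) blast
    fix x assume x: "x \<in> topspace X"
    note r = C01_range[OF assms(1) x] C01_range[OF \<psi> x]
    show "(\<lambda>x\<in>topspace X. T c (\<psi> x)) x \<le> \<phi> x"
    proof (cases "\<phi> x \<le> c")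
      case True
      then have "(\<phi> x - c) / (t - c) \<le> 0" using assms(3) by (simp add: field_simps)
      then have "\<psi> x = \<phi> x" using x r by (simp add: \<psi>_def h_def)
      then show ?thesis using T_le_right[OF c r(2)] x by simp
    next
      case False
      then show ?thesis using T_le_left[OF c r(2)] x by simp
    qed
  qed (rule assms(1))
  finally show ?thesis .
qed

text \<open>For semicontinuity, take \<open>\<phi>\<close> equal to 1 on \<open>F\<close> with
  \<open>\<mu> \<phi> < a\<close>, and \<open>c < 1\<close> with
  \<open>\<mu> \<phi> < T c a\<close>. A closed set \<open>B\<close> inside a superlevel set of
  level above \<open>c\<close> satisfies \<open>T c (induced B) \<le> \<mu> \<phi>\<close>, so its
  value cannot reach \<open>a\<close>.\<close>

lemma induced_capacity: "induced \<in> capacities X"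
proof -
  have "induced (topspace X) = 1"
  proof (rule antisym)
    show "1 \<le> induced (topspace X)"
    proof (rule induced_greatest)
      fix \<phi> assume \<phi>: "\<phi> \<in> C01 X" "\<forall>x\<in>topspace X. \<phi> x = 1"
      then show "1 \<le> \<mu> \<phi>" using \<mu>_mono[OF const_C01[of 1] \<phi>(1)] \<mu>_one by simp
    qed simp
  qed (use induced_range[of "topspace X"] in auto)
  moreover have "induced {} = 0"
    using induced_le[of "{}" "\<lambda>x\<in>topspace X. 0"] const_C01[of 0] \<mu>_zero induced_range[of "{}"] by simp
  moreover have "induced F \<le> induced G" if "closedin X F" "closedin X G" "F \<subseteq> G" for F G
    using that by (intro induced_greatest induced_le) auto
  moreover have "\<exists>U. openin X U \<and> F \<subseteq> U \<and> (\<forall>B. compactin X B \<longrightarrow> B \<subseteq> U \<longrightarrow> induced B < a)"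
    if F: "closedin X F" and a: "induced F < a" for F a
  proof -
    have closed: "closedin X B" if "compactin X B" for B
      using that compactum by (auto simp: compactum_def intro: compactin_imp_closedin)
    show ?thesis
    \<comment> \<open>For \<open>a > 1\<close> every value is below \<open>a\<close> and the whole
      space works; otherwise \<open>a\<close> is a legitimate argument of \<open>T\<close>.\<close>
    proof (cases "a \<le> 1")
      case False
      then have "induced B < a" if "compactin X B" for B using induced_range[OF closed[OF that]] by simp
      then show ?thesis using closedin_subset[OF F] by (intro exI[of _ "topspace X"]) auto
    next
      case True
      then have a01: "a \<in> {0..1}" using a induced_range[OF F] by simp
      obtain \<phi> where \<phi>: "\<phi> \<in> C01 X" "\<forall>x\<in>F. \<phi> x = 1" "\<mu> \<phi> < a" using induced_less[OF F a] .
      have "\<mu> \<phi> < T 1 a" using \<phi>(3) one_T[OF a01] by simp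
      then obtain c where c: "0 \<le> c" "c < 1" "\<mu> \<phi> < T c a"
        using T_greater_left[of 1 a] a01 by auto
      define t where "t = (c + 1) / 2"
      have t: "c < t" "t < 1" using c by (auto simp: t_def)
      define U where "U = {x \<in> topspace X. \<phi> x \<in> {t<..}}"
      have "continuous_map X euclideanreal \<phi>"
        using \<phi>(1) by (simp add: C01_def continuous_map_in_subtopology)
      then have "openin X U" unfolding U_def by (rule openin_continuous_map_preimage) simp
      moreover have "F \<subseteq> U" using closedin_subset[OF F] \<phi>(2) t by (auto simp: U_def)
      moreover have "induced B < a" if "compactin X B" "B \<subseteq> U" for B
      proof (rule ccontr)
        assume "\<not> induced B < a"
        then have "T c a \<le> T c (induced B)"
          using a01 c induced_range[OF closed[OF that(1)]] by (intro T_mono) auto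
        also have "\<dots> \<le> \<mu> \<phi>"
          using c t that closed by (intro T_superlevel_le_strict[OF \<phi>(1)]) (auto simp: U_def superlevel_def)
        finally show False using c(3) by simp
      qed
      ultimately show ?thesis by blast
    qed
  qed
  moreover have "induced \<in> {F. closedin X F} \<rightarrow>\<^sub>E {0..1}"
    using induced_range by (auto simp: induced_def)
  ultimately show ?thesis unfolding capacities_def by blast
qed

section \<open>Integral representation of the functional\<close>

text \<open>By left continuity of \<open>T\<close>, a violation at level \<open>t\<close> would
  persist at some \<open>c < t\<close>, contradicting the strict version.\<close>

lemma T_superlevel_le:
  assumes "\<phi> \<in> C01 X" and "t \<in> {0..1}"
  shows "T (induced (superlevel X \<phi> t)) t \<le> \<mu> \<phi>"
proof (rule ccontr)
  let ?v = "induced (superlevel X \<phi> t)"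
  note F = superlevel_closedin[OF assms(1), of t]
  note v = induced_range[OF F]
  assume "\<not> ?thesis"
  then have less: "\<mu> \<phi> < T t ?v" using T_commute[OF v assms(2)] by simp
  moreover have "T t ?v \<le> t" by (rule T_le_left[OF assms(2) v])
  ultimately have "t \<in> {0<..1}" using assms(2) \<mu>_range[OF assms(1)] by auto
  then obtain c where "0 \<le> c" "c < t" "\<mu> \<phi> < T c ?v" using T_greater_left v less by metis
  then show False using T_superlevel_le_strict[OF assms(1), of c t "superlevel X \<phi> t"] F assms(2) by simp
qed

text \<open>Let \<open>\<psi>\<close> be the ramp in \<open>\<phi>\<close> from 0 at
  \<open>r\<close> to 1 at \<open>s\<close>. Then \<open>min \<phi> u\<close> is at most the maximum
  of \<open>min \<phi> s\<close> and \<open>T u \<psi>\<close>. Both are nondecreasing in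
  \<open>\<phi>\<close>, hence comonotone, so \<open>\<mu>\<close> splits over the maximum.\<close>

lemma \<mu>_truncation_step:
  assumes "\<phi> \<in> C01 X" and "r < s" and "0 \<le> s" and "s \<le> u" and "u \<le> 1"
  shows "\<mu> (\<lambda>x\<in>topspace X. min (\<phi> x) u)
    \<le> max (\<mu> (\<lambda>x\<in>topspace X. min (\<phi> x) s)) (T (induced (superlevel X \<phi> r)) u)"
proof -
  define h where "h v = max 0 (min 1 ((v - r) / (s - r)))" for v
  have u: "u \<in> {0..1}" using assms by auto
  have trunc: "(\<lambda>x\<in>topspace X. min (\<phi> x) c) \<in> C01 X" if "0 \<le> c" for c
    using that by (intro C01_compose[OF assms(1)]) (auto intro!: continuous_intros)
  define \<psi> where "\<psi> = (\<lambda>x\<in>topspace X. h (\<phi> x))"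
  define \<theta> where "\<theta> = (\<lambda>x\<in>topspace X. T u (\<psi> x))"
  define \<phi>s where "\<phi>s = (\<lambda>x\<in>topspace X. min (\<phi> x) s)"
  have h_mono: "h v \<le> h w" if "v \<le> w" for v w
  proof -
    have "(v - r) / (s - r) \<le> (w - r) / (s - r)" using that assms(2) by (intro divide_right_mono) auto
    then show ?thesis by (auto simp: h_def)
  qed
  have h01: "h v \<in> {0..1}" for v by (auto simp: h_def)
  have h1: "h v = 1" if "s \<le> v" for v
  proof -
    have "1 \<le> (v - r) / (s - r)" using that assms(2) by (simp add: field_simps)
    then show ?thesis by (simp add: h_def)
  qed
  have h0: "h v = 0" if "v \<le> r" for v
  proof -
    have "(v - r) / (s - r) \<le> 0" using that assms(2) by (simp add: divide_nonpos_pos)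
    then show ?thesis by (simp add: h_def)
  qed
  have \<psi>: "\<psi> \<in> C01 X" unfolding \<psi>_def
  proof (rule C01_compose[OF assms(1)])
    show "continuous_on {0..1} h" unfolding h_def using assms(2) by (auto intro!: continuous_intros)
  qed (use h01 in blast)
  have \<theta>: "\<theta> \<in> C01 X" unfolding \<theta>_def
    using T_closed[OF u] by (intro C01_compose[OF \<psi>] T_continuous_right[OF u]) blast
  have \<phi>s: "\<phi>s \<in> C01 X" unfolding \<phi>s_def by (rule trunc[OF assms(3)])
  \<comment> \<open>Since \<open>\<psi>\<close> vanishes where \<open>\<phi> < r\<close>, it lies
    below every function competing in the infimum.\<close>
  have "\<mu> \<psi> \<le> induced (superlevel X \<phi> r)"
  proof (rule induced_greatest[OF superlevel_closedin[OF assms(1)]], rule \<mu>_mono[OF \<psi>])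
    fix \<eta> x assume \<eta>: "\<eta> \<in> C01 X" "\<forall>x\<in>superlevel X \<phi> r. \<eta> x = 1" and x: "x \<in> topspace X"
    show "\<psi> x \<le> \<eta> x"
    proof (cases "r \<le> \<phi> x")
      case True
      then show ?thesis using \<eta>(2) C01_range[OF \<psi> x] x by (auto simp: superlevel_def)
    next
      case False
      then show ?thesis using h0[of "\<phi> x"] C01_range[OF \<eta>(1) x] x by (simp add: \<psi>_def)
    qed
  qed
  then have "T u (\<mu> \<psi>) \<le> T u (induced (superlevel X \<phi> r))"
    using u \<mu>_range[OF \<psi>] induced_range[OF superlevel_closedin[OF assms(1)]] by (intro T_mono) auto
  then have \<mu>\<theta>: "\<mu> \<theta> \<le> T (induced (superlevel X \<phi> r)) u"
    using \<mu>_T[OF u \<psi>] T_commute[OF u induced_range[OF superlevel_closedin[OF assms(1)]]]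
    by (simp add: \<theta>_def)
  have \<theta>_mono: "\<theta> x \<le> \<theta> y" if "x \<in> topspace X" "y \<in> topspace X" "\<phi> x \<le> \<phi> y" for x y
    using that h_mono[OF that(3)] h01 u by (auto simp: \<theta>_def \<psi>_def intro!: T_mono)
  have "comonotone X \<theta> \<phi>s"
    unfolding comonotone_def
  proof (intro ballI)
    fix x y assume xy: "x \<in> topspace X" "y \<in> topspace X"
    show "0 \<le> (\<theta> x - \<theta> y) * (\<phi>s x - \<phi>s y)"
    proof (cases "\<phi> x \<le> \<phi> y")
      case True
      then show ?thesis using \<theta>_mono[OF xy] xy by (intro mult_nonpos_nonpos) (auto simp: \<phi>s_def)
    next
      case False
      then show ?thesis using \<theta>_mono[OF xy(2,1)] xy by (intro mult_nonneg_nonneg) (auto simp: \<phi>s_def)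
    qed
  qed
  then have max: "\<mu> (\<lambda>x\<in>topspace X. max (\<phi>s x) (\<theta> x)) = max (\<mu> \<phi>s) (\<mu> \<theta>)"
    by (rule \<mu>_max[OF \<theta> \<phi>s])
  have "\<mu> (\<lambda>x\<in>topspace X. min (\<phi> x) u) \<le> \<mu> (\<lambda>x\<in>topspace X. max (\<phi>s x) (\<theta> x))"
  proof (rule \<mu>_mono)
    show "(\<lambda>x\<in>topspace X. min (\<phi> x) u) \<in> C01 X" using trunc u by simp
    have "continuous_map X euclideanreal (\<lambda>x. max (\<phi>s x) (\<theta> x))"
      using \<phi>s \<theta> by (intro continuous_map_real_max) (auto simp: C01_def continuous_map_in_subtopology)
    then have "continuous_map X euclideanreal (\<lambda>x\<in>topspace X. max (\<phi>s x) (\<theta> x))"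
      by (rule continuous_map_eq) simp
    moreover have "max (\<phi>s x) (\<theta> x) \<in> {0..1}" if "x \<in> topspace X" for x
      using C01_range[OF \<phi>s that] C01_range[OF \<theta> that] by auto
    ultimately show "(\<lambda>x\<in>topspace X. max (\<phi>s x) (\<theta> x)) \<in> C01 X"
      by (auto simp: C01_def continuous_map_in_subtopology)
    fix x assume x: "x \<in> topspace X"
    show "(\<lambda>x\<in>topspace X. min (\<phi> x) u) x \<le> (\<lambda>x\<in>topspace X. max (\<phi>s x) (\<theta> x)) x"
    proof (cases "s \<le> \<phi> x")
      case True
      then have "\<theta> x = u" using x h1 T_one[OF u] by (simp add: \<theta>_def \<psi>_def)
      then show ?thesis using x by simp
    next
      case False
      then show ?thesis using x by (simp add: \<phi>s_def)
    qed
  qed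
  then show ?thesis using max \<mu>\<theta> by (simp add: \<phi>s_def)
qed

text \<open>If every value of the integrand were below \<open>\<mu> \<phi>\<close>, then by compactness of \<open>[0,1]\<close> the
  truncations \<open>min \<phi> u\<close> would keep their \<open>\<mu>\<close>-value below \<open>\<mu> \<phi>\<close> all the way from \<open>u = 0\<close>
  to \<open>u = 1\<close>.\<close>

lemma \<mu>_attained:
  assumes "\<phi> \<in> C01 X"
  shows "\<exists>t\<in>{0..1}. \<mu> \<phi> \<le> T (induced (superlevel X \<phi> t)) t"
proof (rule ccontr)
  assume "\<not> ?thesis"
  then have less: "T (induced (superlevel X \<phi> t)) t < \<mu> \<phi>" if "t \<in> {0..1}" for t
    using that by force
  let ?trunc = "\<lambda>u. \<mu> (\<lambda>x\<in>topspace X. min (\<phi> x) u)"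
  \<comment> \<open>\<open>P\<close> transports the strict bound from \<open>s\<close> to
    \<open>u\<close>, so it composes along adjacent intervals. The guards cover intervals that leave
    \<open>{0..1}\<close>.\<close>
  define P where "P s u \<longleftrightarrow> (0 \<le> s \<longrightarrow> u \<le> 1 \<longrightarrow> ?trunc s < \<mu> \<phi> \<longrightarrow> ?trunc u < \<mu> \<phi>)" for s u
  have "P 0 1"
  proof (rule Bolzano)
    fix a b c assume "P a b" "P b c" "a \<le> b" "b \<le> c"
    then show "P a c" by (auto simp: P_def)
  next
    fix x :: real assume "0 \<le> x" "x \<le> 1"
    then have x: "x \<in> {0..1}" by simp
    obtain d where "d > 0" and d: "\<And>r u. r > x - d \<Longrightarrow> u \<in> {0..1} \<Longrightarrow> u < x + d \<Longrightarrow>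
        T (induced (superlevel X \<phi> r)) u < \<mu> \<phi>"
      using integrand_less_nbhd[OF induced_capacity assms x less[OF x]] by blast
    have "P s u" if su: "s \<le> x \<and> x \<le> u \<and> u - s < d" for s u
      unfolding P_def
    proof (intro impI)
      assume *: "0 \<le> s" "u \<le> 1" "?trunc s < \<mu> \<phi>"
      \<comment> \<open>Because \<open>x \<le> u < s + d\<close>, there is room between
        \<open>x - d\<close> and \<open>s\<close> for a ramp whose lower end is still within reach
        of the local bound.\<close>
      define r where "r = (x - d + s) / 2"
      have r: "x - d < r" "r < s" using su by (auto simp: r_def)
      have "T (induced (superlevel X \<phi> r)) u < \<mu> \<phi>" using d[OF r(1), of u] su * by simp
      then show "?trunc u < \<mu> \<phi>"
        using \<mu>_truncation_step[OF assms r(2) *(1) _ *(2)] su *(3) by force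
    qed
    with \<open>d > 0\<close> show "\<exists>d>0. \<forall>s u. s \<le> x \<and> x \<le> u \<and> u - s < d \<longrightarrow> P s u" by blast
  qed simp
  moreover have "(\<lambda>x\<in>topspace X. min (\<phi> x) 0) = (\<lambda>x\<in>topspace X. 0)"
    using C01_range[OF assms] by (auto simp: restrict_def)
  then have "?trunc 0 = 0" using \<mu>_zero by simp
  \<comment> \<open>The integrand at level 0 is 0, so the assumed strict inequality there starts the
    transport at truncation 0.\<close>
  moreover have "0 < \<mu> \<phi>"
    using less[of 0] T_zero[OF induced_range[OF superlevel_closedin[OF assms]], of 0] by simp
  moreover have "(\<lambda>x\<in>topspace X. min (\<phi> x) 1) = \<phi>"
    using C01_range[OF assms] assms by (intro ext) (auto simp: restrict_def C01_def extensional_def)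
  ultimately show False by (simp add: P_def)
qed

lemma \<mu>_eq_t_integral:
  assumes "\<phi> \<in> C01 X"
  shows "\<mu> \<phi> = t_integral T X \<phi> induced"
proof -
  obtain t where "t \<in> {0..1}" "\<mu> \<phi> \<le> T (induced (superlevel X \<phi> t)) t"
    using \<mu>_attained[OF assms] by blast
  then have "t_integral T X \<phi> induced = \<mu> \<phi>"
    unfolding t_integral_def using T_superlevel_le[OF assms]
    by (intro Greatest_equality) (auto intro!: exI[of _ t] antisym)
  then show ?thesis by simp
qed

section \<open>Transfer of balancedness between functional and capacity\<close>

text \<open>A function in \<open>C01 X\<close> that dominates the indicator of \<open>A i\<close> is
  1 on \<open>A i\<close>, so its value bounds \<open>induced (A i)\<close> from above.\<close>

lemma balanced_induced:
  assumes "\<mu> \<in> balanced_functionals T X"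
  shows "induced \<in> balanced_capacities X"
  unfolding balanced_capacities_def
proof (intro CollectI conjI allI impI)
  fix n l A assume sub: "subpartition X n l A"
  then obtain \<phi> where \<phi>: "\<And>i. i \<in> {1..n} \<Longrightarrow> \<phi> i \<in> C01 X"
    "\<And>i x. i \<in> {1..n} \<Longrightarrow> x \<in> topspace X \<Longrightarrow> indicat_real (A i) x \<le> \<phi> i x"
    "(\<Sum>i=1..n. l i * \<mu> (\<phi> i)) \<le> 1"
    using assms unfolding balanced_functionals_def by blast
  have "(\<Sum>i=1..n. l i * induced (A i)) \<le> (\<Sum>i=1..n. l i * \<mu> (\<phi> i))"
  proof (intro sum_mono mult_left_mono)
    fix i assume i: "i \<in> {1..n}"
    have A: "closedin X (A i)" and l: "0 \<le> l i" using sub i by (auto simp: subpartition_def)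
    show "0 \<le> l i" by (rule l)
    show "induced (A i) \<le> \<mu> (\<phi> i)"
    proof (rule induced_le[OF A \<phi>(1)[OF i]])
      fix x assume "x \<in> A i"
      moreover from this have "x \<in> topspace X" using closedin_subset[OF A] by blast
      ultimately show "\<phi> i x = 1" using \<phi>(2)[OF i] C01_range[OF \<phi>(1)[OF i]] by fastforce
    qed
  qed
  then show "(\<Sum>i=1..n. l i * induced (A i)) \<le> 1" using \<phi>(3) by linarith
qed (rule induced_capacity)

text \<open>Balancedness of \<open>\<nu>\<close> is applied to the thickened sets
  \<open>B i\<close>: the functions vanish outside them, so their integrals are at most
  \<open>\<nu> (B i)\<close>.\<close>

lemma balanced_if_t_integral:
  assumes "\<nu> \<in> balanced_capacities X" and "\<And>\<phi>. \<phi> \<in> C01 X \<Longrightarrow> \<mu> \<phi> = t_integral T X \<phi> \<nu>"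
  shows "\<mu> \<in> balanced_functionals T X"
  unfolding balanced_functionals_def
proof (intro CollectI conjI allI impI)
  fix n l A assume sub: "subpartition X n l A"
  obtain \<phi> B where B: "subpartition X n l B"
    and \<phi>: "\<And>i. i \<in> {1..n} \<Longrightarrow> \<phi> i \<in> C01 X"
    "\<And>i x. i \<in> {1..n} \<Longrightarrow> x \<in> A i \<Longrightarrow> \<phi> i x = 1"
    "\<And>i x. i \<in> {1..n} \<Longrightarrow> x \<in> topspace X - B i \<Longrightarrow> \<phi> i x = 0"
    by (rule subpartition_thicken[OF compactum sub]) blast
  have \<nu>: "\<nu> \<in> capacities X" using assms(1) by (simp add: balanced_capacities_def)
  have "(\<Sum>i=1..n. l i * \<mu> (\<phi> i)) \<le> (\<Sum>i=1..n. l i * \<nu> (B i))"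
    using B \<phi>(1,3) assms(2) t_integral_le_capacity[OF \<nu>]
    by (intro sum_mono mult_left_mono) (auto simp: subpartition_def)
  also have "\<dots> \<le> 1" using assms(1) B by (auto simp: balanced_capacities_def)
  finally have "(\<Sum>i=1..n. l i * \<mu> (\<phi> i)) \<le> 1" .
  moreover have "indicat_real (A i) x \<le> \<phi> i x" if "i \<in> {1..n}" "x \<in> topspace X" for i x
    using \<phi>(2)[OF that(1), of x] C01_range[OF \<phi>(1)[OF that(1)] that(2)] by (auto simp: indicator_def)
  ultimately show "\<exists>\<phi>. (\<forall>i\<in>{1..n}. \<phi> i \<in> C01 X \<and>
      (\<forall>x\<in>topspace X. indicat_real (A i) x \<le> \<phi> i x)) \<and> (\<Sum>i=1..n. l i * \<mu> (\<phi> i)) \<le> 1"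
    using \<phi>(1) by blast
qed (rule functional)

end

theorem theorem3:
  fixes T :: "real \<Rightarrow> real \<Rightarrow> real"
    and X :: "'a topology"
    and \<mu> :: "('a \<Rightarrow> real) \<Rightarrow> real"
  assumes "continuous_t_norm T"
    and "compactum X"
    and "\<mu> \<in> t_functionals T X"
  shows "\<mu> \<in> balanced_functionals T X \<longleftrightarrow>
    (\<exists>\<nu>\<in>balanced_capacities X. \<forall>\<phi>\<in>C01 X. \<mu> \<phi> = t_integral T X \<phi> \<nu>)"
proof -
  interpret t_functional T X \<mu> by unfold_locales (fact assms)+
  show ?thesis using balanced_induced \<mu>_eq_t_integral balanced_if_t_integral by blast
qed

end
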